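(* In the absence of the external force ($\mathscr F=\bm 0$), both of the following fully discrete schemes (CN1 and CN2) satisfy, at every step $n$ at which the scheme is applied, the discrete energy dissipation law $$\frac{E_h^{n+1}-E_h^n}{\tau}=\nu\big(\Delta_h\bm U^{n+\frac12},\bm U^{n+\frac12}\big)_h,\qquad E_h^n=\frac12\|\bm U^n\|_h^2,$$ where $\bm U^{n+\frac12}=(\bm U^n+\bm U^{n+1})/2$. CN1: given $\bm U^0\in[V_{ew};V_{ns}]$, for $0\le n\le N_t-1$, $\bm U^{n+1}\in[V_{ew};V_{ns}]$ and $P^{n+\frac12}\in V_c$ satisfy $$\frac{\bm U^{n+1}-\bm U^n}{\tau}-\nu\Delta_h\bm U^{n+\frac12}+\bm B(\bm U^n,\bm U^{n+\frac12})+\nabla_DP^{n+\frac12}=\mathscr F^{n+\frac12},\qquad \nabla_d\cdot\bm U^{n+\frac12}=\bm 0 .$$ CN2: given $\bm U^0\in[V_{ew};V_{ns}]$, and $\bm U^1$ obtained from the CN1 scheme, for $1\le n\le N_t-1$, $\bm U^{n+1}\in[V_{ew};V_{ns}]$ and $P^{n+\frac12}\in V_c$ satisfy $$\frac{\bm U^{n+1}-\bm U^n}{\tau}-\nu\Delta_h\bm U^{n+\frac12}+\bm B(\overline{\bm U}^{n+\frac12},\bm U^{n+\frac12})+\nabla_DP^{n+\frac12}=\mathscr F^{n+\frac12},\qquad \nabla_d\cdot\bm U^{n+\frac12}=\bm 0,$$ with $\overline{\bm U}^{n+\frac12}=(3\bm U^n-\bm U^{n-1})/2$.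
   Context: Setting: two space dimensions with periodic boundary conditions on $[0,L_x]\times[0,L_y]$; $N_x,N_y,N_t$ are positive integers, $h_x=L_x/N_x$, $h_y=L_y/N_y$, $T>0$, $\tau=T/N_t$, $\nu>0$. $V_{ew},V_{ns},V_c$ are the spaces of real grid functions on, respectively, the points $(x_{i+1/2},y_j)$ ($0\le i\le N_x-1$, $1\le j\le N_y$), $(x_i,y_{j+1/2})$ ($1\le i\le N_x$, $0\le j\le N_y-1$), $(x_i,y_j)$ ($1\le i\le N_x$, $1\le j\le N_y$), where $x_l=(l-\frac12)h_x$, $y_l=(l-\frac12)h_y$; each is identified with the real $N_x\times N_y$ matrices. $[V_{ew};V_{ns}]$ is the space of pairs $\bm U=[U;V]$ with $U\in V_{ew}$, $V\in V_{ns}$. For matrices of equal size, $(A,B)_h=h_xh_y\mathrm{Tr}(A^TB)$, $\|A\|_h=\sqrt{(A,A)_h}$; for pairs, the inner products of the components are summed. Differentiation matrices ($N\times N$, acting on $w\in\mathbb R^N$ with indices modulo $N$): $(\mathbb C(N)w)_i=\frac12(w_i+w_{i+1})$, $(\mathbb D_1(N,h)w)_i=\frac{1}{2h}(w_{i+1}-w_{i-1})$, $(\mathbb D_2(N,h)w)_i=\frac1h(w_{i+1}-w_i)$, $(\mathbb D_3(N,h)w)_i=\frac1{h^2}(w_{i+1}-2w_i+w_{i-1})$. Put $\mathbb A_1=\mathbb C(N_x)$, $\mathbb A_2=\mathbb D_1(N_x,h_x)$, $\mathbb A_3=\mathbb D_2(N_x,h_x)$, $\mathbb A_4=\mathbb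 D_3(N_x,h_x)$, and $\mathbb B_1=\mathbb C(N_y)$, $\mathbb B_2=\mathbb D_1(N_y,h_y)$, $\mathbb B_3=\mathbb D_2(N_y,h_y)$, $\mathbb B_4=\mathbb D_3(N_y,h_y)$. Discrete operators: $\nabla_d\cdot\bm U=\mathbb A_3U+V\mathbb B_3^T\in V_c$; $\nabla_DP=[-\mathbb A_3^TP;\,-P\mathbb B_3]\in[V_{ew};V_{ns}]$; $\Delta_hW=\mathbb A_4W+W\mathbb B_4^T$, applied componentwise to pairs. $\bm F:[V_{ew};V_{ns}]\to[V_{ew};V_{ns}]$ is a given map with $(\bm F(\bm U),\bm U)_h\ne0$ whenever $\|\bm U\|_h\neq0$. $\bm G(\bm U)=[G_1(\bm U);G_2(\bm U)]$ is $\bm 0$ if $\|\bm U\|_h=0$, and otherwise $$G_1(\bm U)=\frac{U\odot(\mathbb A_2U)-\big((\mathbb A_1^TV)\odot(U\mathbb B_3)\big)\mathbb B_1^T}{(\bm F(\bm U),\bm U)_h},\qquad G_2(\bm U)=\frac{V\odot(V\mathbb B_2^T)-\mathbb A_1\big((\mathbb A_3^TV)\odot(U\mathbb B_1)\big)}{(\bm F(\bm U),\bm U)_h},$$ with $\odot$ the Hadamard (entrywise) product. For $\bm U,\bm W\in[V_{ew};V_{ns}]$, $$\bm B(\bm U,\bm W)=\big(\bm F(\bm U),\bm W\big)_h\bm G(\bm U)-\big(\bm G(\bm U),\bm W\big)_h\bm F(\bm U).$$ $\mathscr F^{n+\frac12}\in[V_{ew};V_{ns}]$ is the spatial discretization of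 the external force. *)

theory Defs
  imports "Jordan_Normal_Form.Matrix" "HOL-Library.Product_Plus"
begin

text \<open>
  Grid functions on each of the three staggered grids are identified with real
  \<open>Nx \<times> Ny\<close> matrices; rows and columns are numbered from 0.  Pairs \<open>[U; V]\<close> are
  added and subtracted componentwise (\<^theory>\<open>HOL-Library.Product_Plus\<close>).
\<close>

type_synonym velocity = "real mat \<times> real mat"

definition cell_space :: "nat \<Rightarrow> nat \<Rightarrow> real mat set" where
  "cell_space Nx Ny = carrier_mat Nx Ny"

definition velocity_space :: "nat \<Rightarrow> nat \<Rightarrow> velocity set" where
  "velocity_space Nx Ny = carrier_mat Nx Ny \<times> carrier_mat Nx Ny"

definition velocity_zero :: "nat \<Rightarrow> nat \<Rightarrow> velocity" where
  "velocity_zero Nx Ny = (0\<^sub>m Nx Ny, 0\<^sub>m Nx Ny)"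

definition scale :: "real \<Rightarrow> velocity \<Rightarrow> velocity" where
  "scale c U = (c \<cdot>\<^sub>m fst U, c \<cdot>\<^sub>m snd U)"

definition hadamard :: "real mat \<Rightarrow> real mat \<Rightarrow> real mat" (infixl \<open>\<odot>\<close> 70) where
  "A \<odot> B = mat (dim_row A) (dim_col A) (\<lambda>(i, j). A $$ (i, j) * B $$ (i, j))"

definition mat_trace :: "real mat \<Rightarrow> real" where
  "mat_trace A = (\<Sum>i<dim_row A. A $$ (i, i))"

definition mat_inner :: "real \<Rightarrow> real \<Rightarrow> real mat \<Rightarrow> real mat \<Rightarrow> real" where
  "mat_inner hx hy A B = hx * hy * mat_trace (A\<^sup>T * B)"

definition inner_h :: "real \<Rightarrow> real \<Rightarrow> velocity \<Rightarrow> velocity \<Rightarrow> real" where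
  "inner_h hx hy U W = mat_inner hx hy (fst U) (fst W) + mat_inner hx hy (snd U) (snd W)"

definition norm_h :: "real \<Rightarrow> real \<Rightarrow> velocity \<Rightarrow> real" where
  "norm_h hx hy U = sqrt (inner_h hx hy U U)"

definition energy :: "real \<Rightarrow> real \<Rightarrow> velocity \<Rightarrow> real" where
  "energy hx hy U = 1/2 * (norm_h hx hy U)\<^sup>2"

text \<open>
  Periodic differentiation matrices.  Entries are sums of Kronecker deltas, so that
  coinciding neighbours (for \<open>N = 1\<close> or \<open>N = 2\<close>) are accumulated.  The index \<open>i - 1\<close>
  modulo \<open>N\<close> is written \<open>(i + N - 1) mod N\<close> because subtraction on \<open>nat\<close> truncates.
\<close>

definition C :: "nat \<Rightarrow> real mat" where
  "C N = mat N N (\<lambda>(i, j). 1/2 * (of_bool (j = i) + of_bool (j = (i + 1) mod N)))"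

definition D1 :: "nat \<Rightarrow> real \<Rightarrow> real mat" where
  "D1 N h = mat N N (\<lambda>(i, j).
     1 / (2 * h) * (of_bool (j = (i + 1) mod N) - of_bool (j = (i + N - 1) mod N)))"

definition D2 :: "nat \<Rightarrow> real \<Rightarrow> real mat" where
  "D2 N h = mat N N (\<lambda>(i, j). 1 / h * (of_bool (j = (i + 1) mod N) - of_bool (j = i)))"

definition D3 :: "nat \<Rightarrow> real \<Rightarrow> real mat" where
  "D3 N h = mat N N (\<lambda>(i, j). 1 / h\<^sup>2 *
     (of_bool (j = (i + 1) mod N) - 2 * of_bool (j = i) + of_bool (j = (i + N - 1) mod N)))"

lemma sum_delta_index:
  fixes w :: "real vec"
  assumes "k < N"
  shows "(\<Sum>j = 0..<N. of_bool (j = k) * w $ j) = w $ k"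
  using assms by (simp add: of_bool_def if_distrib[of "\<lambda>x. x * _"] cong: if_cong)

lemma differentiation_matrices_apply:
  assumes "w \<in> carrier_vec N" "i < N"
  shows "(C N *\<^sub>v w) $ i = 1/2 * (w $ i + w $ ((i + 1) mod N))"
    and "(D1 N h *\<^sub>v w) $ i = 1 / (2 * h) * (w $ ((i + 1) mod N) - w $ ((i + N - 1) mod N))"
    and "(D2 N h *\<^sub>v w) $ i = 1 / h * (w $ ((i + 1) mod N) - w $ i)"
    and "(D3 N h *\<^sub>v w) $ i =
      1 / h\<^sup>2 * (w $ ((i + 1) mod N) - 2 * w $ i + w $ ((i + N - 1) mod N))"
proof -
  have lt: "(i + 1) mod N < N" "(i + N - 1) mod N < N"
    using assms by auto
  note d = sum_delta_index[OF assms(2), of w] sum_delta_index[OF lt(1), of w]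
    sum_delta_index[OF lt(2), of w]
  note s = scalar_prod_def row_def mult.assoc ring_distribs sum.distrib sum_subtractf
  show "(C N *\<^sub>v w) $ i = 1/2 * (w $ i + w $ ((i + 1) mod N))"
    using assms d by (simp add: C_def s flip: sum_distrib_left sum_divide_distrib)
  show "(D1 N h *\<^sub>v w) $ i = 1 / (2 * h) * (w $ ((i + 1) mod N) - w $ ((i + N - 1) mod N))"
    using assms d by (simp add: D1_def s flip: sum_distrib_left sum_divide_distrib)
  show "(D2 N h *\<^sub>v w) $ i = 1 / h * (w $ ((i + 1) mod N) - w $ i)"
    using assms d by (simp add: D2_def s flip: sum_distrib_left sum_divide_distrib)
  show "(D3 N h *\<^sub>v w) $ i =
      1 / h\<^sup>2 * (w $ ((i + 1) mod N) - 2 * w $ i + w $ ((i + N - 1) mod N))"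
    using assms d by (simp add: D3_def s flip: sum_distrib_left sum_divide_distrib)
qed

definition divergence :: "nat \<Rightarrow> nat \<Rightarrow> real \<Rightarrow> real \<Rightarrow> velocity \<Rightarrow> real mat" where
  "divergence Nx Ny hx hy U = D2 Nx hx * fst U + snd U * (D2 Ny hy)\<^sup>T"

definition gradient :: "nat \<Rightarrow> nat \<Rightarrow> real \<Rightarrow> real \<Rightarrow> real mat \<Rightarrow> velocity" where
  "gradient Nx Ny hx hy P = (- ((D2 Nx hx)\<^sup>T * P), - (P * D2 Ny hy))"

definition mat_laplacian :: "nat \<Rightarrow> nat \<Rightarrow> real \<Rightarrow> real \<Rightarrow> real mat \<Rightarrow> real mat" where
  "mat_laplacian Nx Ny hx hy W = D3 Nx hx * W + W * (D3 Ny hy)\<^sup>T"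

definition laplacian :: "nat \<Rightarrow> nat \<Rightarrow> real \<Rightarrow> real \<Rightarrow> velocity \<Rightarrow> velocity" where
  "laplacian Nx Ny hx hy U =
     (mat_laplacian Nx Ny hx hy (fst U), mat_laplacian Nx Ny hx hy (snd U))"

definition G :: "nat \<Rightarrow> nat \<Rightarrow> real \<Rightarrow> real \<Rightarrow> (velocity \<Rightarrow> velocity) \<Rightarrow> velocity \<Rightarrow> velocity" where
  "G Nx Ny hx hy F W =
     (if norm_h hx hy W = 0 then velocity_zero Nx Ny
      else
       (let U = fst W; V = snd W;
            A\<^sub>1 = C Nx; A\<^sub>2 = D1 Nx hx; A\<^sub>3 = D2 Nx hx;
            B\<^sub>1 = C Ny; B\<^sub>2 = D1 Ny hy; B\<^sub>3 = D2 Ny hy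
        in scale (1 / inner_h hx hy (F W) W)
             (U \<odot> (A\<^sub>2 * U) - ((A\<^sub>1\<^sup>T * V) \<odot> (U * B\<^sub>3)) * B\<^sub>1\<^sup>T,
              V \<odot> (V * B\<^sub>2\<^sup>T) - A\<^sub>1 * ((A\<^sub>3\<^sup>T * V) \<odot> (U * B\<^sub>1)))))"

definition B ::
  "nat \<Rightarrow> nat \<Rightarrow> real \<Rightarrow> real \<Rightarrow> (velocity \<Rightarrow> velocity) \<Rightarrow> velocity \<Rightarrow> velocity \<Rightarrow> velocity" where
  "B Nx Ny hx hy F U W =
     scale (inner_h hx hy (F U) W) (G Nx Ny hx hy F U)
     - scale (inner_h hx hy (G Nx Ny hx hy F U) W) (F U)"

definition midpoint :: "velocity \<Rightarrow> velocity \<Rightarrow> velocity" where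
  "midpoint U U' = scale (1/2) (U + U')"

text \<open>
  One Crank--Nicolson step from \<open>U\<close> to \<open>U'\<close>, with force \<open>f\<close> and pressure \<open>P\<close>; \<open>Us\<close> is
  the first argument of \<open>B\<close>, the only place where the two schemes differ.
\<close>

definition CN_step ::
  "nat \<Rightarrow> nat \<Rightarrow> real \<Rightarrow> real \<Rightarrow> real \<Rightarrow> real \<Rightarrow> (velocity \<Rightarrow> velocity) \<Rightarrow> velocity
    \<Rightarrow> velocity \<Rightarrow> velocity \<Rightarrow> velocity \<Rightarrow> real mat \<Rightarrow> bool" where
  "CN_step Nx Ny hx hy \<tau> \<nu> F f Us U U' P \<longleftrightarrow>
     scale (1 / \<tau>) (U' - U) - scale \<nu> (laplacian Nx Ny hx hy (midpoint U U'))
       + B Nx Ny hx hy F Us (midpoint U U') + gradient Nx Ny hx hy P = f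
     \<and> divergence Nx Ny hx hy (midpoint U U') = 0\<^sub>m Nx Ny"

text \<open>In the schemes, \<open>f n\<close> and \<open>P n\<close> are the force and the pressure at time level \<open>n + 1/2\<close>.\<close>

definition CN1 ::
  "nat \<Rightarrow> nat \<Rightarrow> nat \<Rightarrow> real \<Rightarrow> real \<Rightarrow> real \<Rightarrow> real \<Rightarrow> (velocity \<Rightarrow> velocity)
    \<Rightarrow> (nat \<Rightarrow> velocity) \<Rightarrow> (nat \<Rightarrow> velocity) \<Rightarrow> (nat \<Rightarrow> real mat) \<Rightarrow> bool" where
  "CN1 Nx Ny Nt hx hy \<tau> \<nu> F f U P \<longleftrightarrow>
     (\<forall>n\<le>Nt. U n \<in> velocity_space Nx Ny) \<and> (\<forall>n<Nt. P n \<in> cell_space Nx Ny) \<and>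
     (\<forall>n<Nt. CN_step Nx Ny hx hy \<tau> \<nu> F (f n) (U n) (U n) (U (n + 1)) (P n))"

definition CN2 ::
  "nat \<Rightarrow> nat \<Rightarrow> nat \<Rightarrow> real \<Rightarrow> real \<Rightarrow> real \<Rightarrow> real \<Rightarrow> (velocity \<Rightarrow> velocity)
    \<Rightarrow> (nat \<Rightarrow> velocity) \<Rightarrow> (nat \<Rightarrow> velocity) \<Rightarrow> (nat \<Rightarrow> real mat) \<Rightarrow> bool" where
  "CN2 Nx Ny Nt hx hy \<tau> \<nu> F f U P \<longleftrightarrow>
     (\<forall>n\<le>Nt. U n \<in> velocity_space Nx Ny) \<and> (\<forall>n<Nt. P n \<in> cell_space Nx Ny) \<and>
     CN_step Nx Ny hx hy \<tau> \<nu> F (f 0) (U 0) (U 0) (U 1) (P 0) \<and>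
     (\<forall>n. 1 \<le> n \<and> n < Nt \<longrightarrow>
        CN_step Nx Ny hx hy \<tau> \<nu> F (f n) (scale (1/2) (scale 3 (U n) - U (n - 1)))
          (U n) (U (n + 1)) (P n))"

definition dissipation_law ::
  "nat \<Rightarrow> nat \<Rightarrow> real \<Rightarrow> real \<Rightarrow> real \<Rightarrow> real \<Rightarrow> (nat \<Rightarrow> velocity) \<Rightarrow> nat \<Rightarrow> bool" where
  "dissipation_law Nx Ny hx hy \<tau> \<nu> U n \<longleftrightarrow>
     (energy hx hy (U (n + 1)) - energy hx hy (U n)) / \<tau> =
     \<nu> * inner_h hx hy (laplacian Nx Ny hx hy (midpoint (U n) (U (n + 1))))
           (midpoint (U n) (U (n + 1)))"

end

theory Submission
  imports Defs
begin

text \<open>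
  The law is obtained by testing the momentum equation with the midpoint velocity
  \<open>W = (U\<^sup>n + U\<^sup>n\<^sup>+\<^sup>1) / 2\<close>.  Three facts decide the outcome.

  The difference quotient turns into the increment of the energy, because
  \<open>(U' - U, U' + U) = \<parallel>U'\<parallel>\<^sup>2 - \<parallel>U\<parallel>\<^sup>2\<close> for a symmetric bilinear form
  (\<open>inner_h_diff_midpoint\<close>).  The nonlinear term drops out: \<open>B(U\<^sub>*, _)\<close> is the rank-two
  map \<open>W \<mapsto> (F, W) G - (G, W) F\<close>, which is skew for all vectors \<open>F\<close> and \<open>G\<close>
  (\<open>inner_h_B_self\<close>).  As this holds at every \<open>U\<^sub>*\<close>, CN1 and CN2 are both covered by
  \<open>CN_step_dissipation\<close>.  The pressure drops out because the discrete gradient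
  is minus the adjoint of the discrete divergence (\<open>inner_h_gradient\<close>) and \<open>W\<close> is
  discretely divergence free.  Only the viscous term survives.
\<close>

section \<open>The discrete inner product\<close>

text \<open>
  The trace form is convenient for adjoints, the entrywise form for linearity, symmetry
  and positivity.
\<close>

lemma mat_inner_eq_sum:
  assumes "A \<in> carrier_mat m n" "A' \<in> carrier_mat m n"
  shows "mat_inner hx hy A A' = hx * hy * (\<Sum>j<n. \<Sum>i<m. A $$ (i, j) * A' $$ (i, j))"
  using assms
  by (simp add: mat_inner_def mat_trace_def scalar_prod_def lessThan_atLeast0)

lemma mat_trace_mult_commute:
  assumes "A \<in> carrier_mat m n" "A' \<in> carrier_mat n m"
  shows "mat_trace (A * A') = mat_trace (A' * A)"
proof -
  have "mat_trace (A * A') = (\<Sum>i<m. \<Sum>j<n. A $$ (i, j) * A' $$ (j, i))"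
    using assms by (simp add: mat_trace_def scalar_prod_def lessThan_atLeast0)
  also have "\<dots> = (\<Sum>j<n. \<Sum>i<m. A' $$ (j, i) * A $$ (i, j))"
    by (subst sum.swap) (simp add: mult.commute)
  also have "\<dots> = mat_trace (A' * A)"
    using assms by (simp add: mat_trace_def scalar_prod_def lessThan_atLeast0)
  finally show ?thesis .
qed

lemma mat_inner_mult_left_adjoint:
  assumes "M \<in> carrier_mat k m" "P \<in> carrier_mat k n" "U \<in> carrier_mat m n"
  shows "mat_inner hx hy (M\<^sup>T * P) U = mat_inner hx hy P (M * U)"
proof -
  have "(M\<^sup>T * P)\<^sup>T * U = P\<^sup>T * (M * U)"
    using assms by (simp add: transpose_mult[of _ m k _ n] assoc_mult_mat[of _ n k _ m _ n])
  then show ?thesis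
    by (simp add: mat_inner_def)
qed

lemma mat_inner_mult_right_adjoint:
  assumes "M \<in> carrier_mat k n" "P \<in> carrier_mat m k" "V \<in> carrier_mat m n"
  shows "mat_inner hx hy (P * M) V = mat_inner hx hy P (V * M\<^sup>T)"
proof -
  have "mat_trace ((P * M)\<^sup>T * V) = mat_trace (M\<^sup>T * (P\<^sup>T * V))"
    using assms by (simp add: transpose_mult[of _ m k _ n] assoc_mult_mat[of _ n k _ m _ n])
  also have "\<dots> = mat_trace ((P\<^sup>T * V) * M\<^sup>T)"
    using assms by (intro mat_trace_mult_commute[of _ n k]) auto
  also have "(P\<^sup>T * V) * M\<^sup>T = P\<^sup>T * (V * M\<^sup>T)"
    using assms by (intro assoc_mult_mat[of _ k m _ n _ k]) auto
  finally show ?thesis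
    by (simp add: mat_inner_def)
qed

lemma inner_h_eq_sum:
  assumes "U \<in> velocity_space m n" "W \<in> velocity_space m n"
  shows "inner_h hx hy U W =
    hx * hy * (\<Sum>j<n. \<Sum>i<m. fst U $$ (i, j) * fst W $$ (i, j) + snd U $$ (i, j) * snd W $$ (i, j))"
  using assms
  by (auto simp: inner_h_def velocity_space_def mat_inner_eq_sum sum.distrib distrib_left)

lemma velocity_space_add:
  "U \<in> velocity_space m n \<Longrightarrow> W \<in> velocity_space m n \<Longrightarrow> U + W \<in> velocity_space m n"
  by (auto simp: velocity_space_def)

lemma velocity_space_diff:
  "U \<in> velocity_space m n \<Longrightarrow> W \<in> velocity_space m n \<Longrightarrow> U - W \<in> velocity_space m n"
  by (auto simp: velocity_space_def intro!: minus_carrier_mat)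

lemma velocity_space_scale:
  "U \<in> velocity_space m n \<Longrightarrow> scale c U \<in> velocity_space m n"
  by (auto simp: velocity_space_def scale_def)

lemma velocity_space_zero: "velocity_zero m n \<in> velocity_space m n"
  by (simp add: velocity_space_def velocity_zero_def)

lemma velocity_space_midpoint:
  "U \<in> velocity_space m n \<Longrightarrow> W \<in> velocity_space m n \<Longrightarrow> midpoint U W \<in> velocity_space m n"
  by (simp add: midpoint_def velocity_space_scale velocity_space_add)

lemma inner_h_commute:
  assumes "U \<in> velocity_space m n" "W \<in> velocity_space m n"
  shows "inner_h hx hy U W = inner_h hx hy W U"
  using assms by (simp add: inner_h_eq_sum mult.commute)

lemma inner_h_add_left:
  assumes "U \<in> velocity_space m n" "V \<in> velocity_space m n" "W \<in> velocity_space m n"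
  shows "inner_h hx hy (U + V) W = inner_h hx hy U W + inner_h hx hy V W"
proof -
  have "fst (U + V) $$ (i, j) = fst U $$ (i, j) + fst V $$ (i, j)"
       "snd (U + V) $$ (i, j) = snd U $$ (i, j) + snd V $$ (i, j)" if "i < m" "j < n" for i j
    using assms that by (auto simp: velocity_space_def)
  then show ?thesis
    using assms
    by (simp add: inner_h_eq_sum[of _ m n] velocity_space_add algebra_simps sum.distrib)
qed

lemma inner_h_diff_left:
  assumes "U \<in> velocity_space m n" "V \<in> velocity_space m n" "W \<in> velocity_space m n"
  shows "inner_h hx hy (U - V) W = inner_h hx hy U W - inner_h hx hy V W"
proof -
  have "fst (U - V) $$ (i, j) = fst U $$ (i, j) - fst V $$ (i, j)"
       "snd (U - V) $$ (i, j) = snd U $$ (i, j) - snd V $$ (i, j)" if "i < m" "j < n" for i j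
    using assms that by (auto simp: velocity_space_def)
  then show ?thesis
    using assms
    by (simp add: inner_h_eq_sum[of _ m n] velocity_space_diff left_diff_distrib right_diff_distrib
        distrib_left sum.distrib sum_subtractf)
qed

lemma inner_h_scale_left:
  assumes "U \<in> velocity_space m n" "W \<in> velocity_space m n"
  shows "inner_h hx hy (scale c U) W = c * inner_h hx hy U W"
proof -
  have "fst (scale c U) $$ (i, j) = c * fst U $$ (i, j)"
       "snd (scale c U) $$ (i, j) = c * snd U $$ (i, j)" if "i < m" "j < n" for i j
    using assms that by (auto simp: velocity_space_def scale_def)
  then show ?thesis
    using assms
    by (simp add: inner_h_eq_sum[of _ m n] velocity_space_scale algebra_simps sum.distrib
        sum_distrib_left)
qed

lemma inner_h_zero_left:
  assumes "W \<in> velocity_space m n"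
  shows "inner_h hx hy (velocity_zero m n) W = 0"
  using assms
  by (simp add: inner_h_eq_sum[of _ m n] velocity_space_zero) (simp add: velocity_zero_def)

lemma inner_h_self_nonneg:
  assumes "U \<in> velocity_space m n" "hx \<ge> 0" "hy \<ge> 0"
  shows "inner_h hx hy U U \<ge> 0"
  using assms by (simp add: inner_h_eq_sum[of _ m n] sum_nonneg)

lemma energy_eq_inner_h:
  assumes "U \<in> velocity_space m n" "hx \<ge> 0" "hy \<ge> 0"
  shows "energy hx hy U = inner_h hx hy U U / 2"
  using inner_h_self_nonneg[OF assms] by (simp add: energy_def norm_h_def)

text \<open>
  Symmetry cancels the mixed terms of \<open>(U' - U, U' + U)\<close>; this is why the midpoint, and not
  another average, is the right test function.
\<close>

lemma inner_h_diff_midpoint: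
  assumes "U \<in> velocity_space m n" "U' \<in> velocity_space m n" "hx \<ge> 0" "hy \<ge> 0"
  shows "inner_h hx hy (U' - U) (midpoint U U') = energy hx hy U' - energy hx hy U"
proof -
  have "inner_h hx hy (U' - U) (midpoint U U') = inner_h hx hy (midpoint U U') (U' - U)"
    using assms by (intro inner_h_commute) (auto intro: velocity_space_diff velocity_space_midpoint)
  also have "\<dots> = (inner_h hx hy U (U' - U) + inner_h hx hy U' (U' - U)) / 2"
    using assms
    by (simp add: midpoint_def inner_h_scale_left[of _ m n] inner_h_add_left[of _ m n]
        velocity_space_add velocity_space_diff)
  also have "\<dots> = (inner_h hx hy (U' - U) U + inner_h hx hy (U' - U) U') / 2"
    using assms by (simp add: inner_h_commute[of _ m n "U' - U"] velocity_space_diff)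
  also have "\<dots> = (inner_h hx hy U' U' - inner_h hx hy U U) / 2"
    using assms by (simp add: inner_h_diff_left[of _ m n] inner_h_commute[of U m n U'])
  finally show ?thesis
    using assms by (simp add: energy_eq_inner_h[of _ m n] diff_divide_distrib)
qed

section \<open>The discrete operators under the inner product\<close>

lemma D2_carrier: "D2 N h \<in> carrier_mat N N"
  by (simp add: D2_def)

lemma laplacian_in_velocity_space:
  assumes "U \<in> velocity_space Nx Ny"
  shows "laplacian Nx Ny hx hy U \<in> velocity_space Nx Ny"
  using assms by (auto simp: laplacian_def mat_laplacian_def velocity_space_def D3_def)

lemma gradient_in_velocity_space:
  assumes "P \<in> cell_space Nx Ny"
  shows "gradient Nx Ny hx hy P \<in> velocity_space Nx Ny"
  using assms by (auto simp: gradient_def velocity_space_def cell_space_def D2_def)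

lemma G_in_velocity_space:
  assumes "U \<in> velocity_space Nx Ny"
  shows "G Nx Ny hx hy F U \<in> velocity_space Nx Ny"
  using assms
  by (auto simp: G_def Let_def scale_def velocity_zero_def velocity_space_def hadamard_def
      C_def D1_def D2_def)

lemma B_in_velocity_space:
  assumes "U \<in> velocity_space Nx Ny" "F U \<in> velocity_space Nx Ny"
  shows "B Nx Ny hx hy F U W \<in> velocity_space Nx Ny"
  using assms by (simp add: B_def velocity_space_diff velocity_space_scale G_in_velocity_space)

text \<open>
  Testing the rank-two form with its own argument gives \<open>(F, W) (G, W) - (G, W) (F, W)\<close>.
\<close>

lemma inner_h_B_self:
  assumes "U \<in> velocity_space Nx Ny" "F U \<in> velocity_space Nx Ny" "W \<in> velocity_space Nx Ny"
  shows "inner_h hx hy (B Nx Ny hx hy F U W) W = 0"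
  using assms
  by (simp add: B_def inner_h_diff_left[of _ Nx Ny] inner_h_scale_left[of _ Nx Ny]
      velocity_space_scale G_in_velocity_space)

text \<open>
  Summation by parts on the staggered grid.  Periodicity leaves no boundary terms, so it is
  the plain transposition rule for the difference matrices.
\<close>

lemma inner_h_gradient:
  assumes "P \<in> cell_space Nx Ny" "W \<in> velocity_space Nx Ny"
  shows "inner_h hx hy (gradient Nx Ny hx hy P) W =
    - mat_inner hx hy P (divergence Nx Ny hx hy W)"
proof -
  obtain U V where W: "W = (U, V)" "U \<in> carrier_mat Nx Ny" "V \<in> carrier_mat Nx Ny"
    using assms by (auto simp: velocity_space_def)
  have P: "P \<in> carrier_mat Nx Ny"
    using assms by (simp add: cell_space_def)
  have uminus: "mat_inner hx hy (- A) A' = - mat_inner hx hy A A'"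
    if "A \<in> carrier_mat Nx Ny" "A' \<in> carrier_mat Nx Ny" for A A'
    using that by (simp add: mat_inner_eq_sum[of _ Nx Ny] sum_negf)
  have add: "mat_inner hx hy A (A' + A'') = mat_inner hx hy A A' + mat_inner hx hy A A''"
    if "A \<in> carrier_mat Nx Ny" "A' \<in> carrier_mat Nx Ny" "A'' \<in> carrier_mat Nx Ny" for A A' A''
    using that by (simp add: mat_inner_eq_sum[of _ Nx Ny] sum.distrib algebra_simps)
  have carriers: "(D2 Nx hx)\<^sup>T * P \<in> carrier_mat Nx Ny" "P * D2 Ny hy \<in> carrier_mat Nx Ny"
    "D2 Nx hx * U \<in> carrier_mat Nx Ny" "V * (D2 Ny hy)\<^sup>T \<in> carrier_mat Nx Ny"
    using P W by (auto simp: D2_def)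
  have "inner_h hx hy (gradient Nx Ny hx hy P) W =
      - (mat_inner hx hy ((D2 Nx hx)\<^sup>T * P) U + mat_inner hx hy (P * D2 Ny hy) V)"
    by (simp add: inner_h_def gradient_def W uminus carriers)
  also have "\<dots> = - (mat_inner hx hy P (D2 Nx hx * U) + mat_inner hx hy P (V * (D2 Ny hy)\<^sup>T))"
    using mat_inner_mult_left_adjoint[OF D2_carrier P W(2)]
      mat_inner_mult_right_adjoint[OF D2_carrier P W(3)]
    by simp
  also have "\<dots> = - mat_inner hx hy P (divergence Nx Ny hx hy W)"
    by (simp add: divergence_def W add P carriers)
  finally show ?thesis .
qed

lemma mat_inner_zero_right:
  assumes "P \<in> carrier_mat m n"
  shows "mat_inner hx hy P (0\<^sub>m m n) = 0"
  using assms by (simp add: mat_inner_eq_sum[of _ m n])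

section \<open>Energy dissipation\<close>

text \<open>
  Testing one step with its midpoint velocity.  CN1 is the case \<open>Us = U\<close>; in CN2, \<open>Us\<close> is
  the extrapolation from the two preceding levels.
\<close>

lemma CN_step_dissipation:
  assumes step: "CN_step Nx Ny hx hy \<tau> \<nu> F (velocity_zero Nx Ny) Us U U' P"
    and Us: "Us \<in> velocity_space Nx Ny" "F Us \<in> velocity_space Nx Ny"
    and U: "U \<in> velocity_space Nx Ny" "U' \<in> velocity_space Nx Ny"
    and P: "P \<in> cell_space Nx Ny"
    and h: "hx \<ge> 0" "hy \<ge> 0"
  shows "(energy hx hy U' - energy hx hy U) / \<tau> =
    \<nu> * inner_h hx hy (laplacian Nx Ny hx hy (midpoint U U')) (midpoint U U')"
proof -
  define W where "W = midpoint U U'"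
  have W: "W \<in> velocity_space Nx Ny"
    using U by (simp add: W_def velocity_space_midpoint)
  define Q where "Q = scale (1 / \<tau>) (U' - U)"
  define L where "L = scale \<nu> (laplacian Nx Ny hx hy W)"
  define N where "N = B Nx Ny hx hy F Us W"
  define R where "R = gradient Nx Ny hx hy P"
  have carriers: "Q \<in> velocity_space Nx Ny" "L \<in> velocity_space Nx Ny"
    "N \<in> velocity_space Nx Ny" "R \<in> velocity_space Nx Ny"
    using U W Us P
    by (auto simp: Q_def L_def N_def R_def intro!: velocity_space_scale velocity_space_diff
        laplacian_in_velocity_space B_in_velocity_space gradient_in_velocity_space)
  have eq: "Q - L + N + R = velocity_zero Nx Ny"
    and div: "divergence Nx Ny hx hy W = 0\<^sub>m Nx Ny"
    using step by (simp_all add: CN_step_def Q_def L_def N_def R_def W_def)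
  have "0 = inner_h hx hy (Q - L + N + R) W"
    using W by (simp add: eq inner_h_zero_left)
  also have "\<dots> = inner_h hx hy Q W - inner_h hx hy L W + inner_h hx hy N W + inner_h hx hy R W"
    using carriers W
    by (simp add: inner_h_add_left[of _ Nx Ny] inner_h_diff_left[of _ Nx Ny]
        velocity_space_add velocity_space_diff)
  also have "inner_h hx hy N W = 0"
    using Us W by (simp add: N_def inner_h_B_self)
  also have "inner_h hx hy R W = 0"
    using P W by (simp add: R_def inner_h_gradient div mat_inner_zero_right cell_space_def)
  also have "inner_h hx hy L W = \<nu> * inner_h hx hy (laplacian Nx Ny hx hy W) W"
    using W by (simp add: L_def inner_h_scale_left[of _ Nx Ny] laplacian_in_velocity_space)
  also have "inner_h hx hy Q W = inner_h hx hy (U' - U) W / \<tau>"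
    using W U by (simp add: Q_def inner_h_scale_left[of _ Nx Ny] velocity_space_diff)
  also have "inner_h hx hy (U' - U) W = energy hx hy U' - energy hx hy U"
    using U h by (simp add: W_def inner_h_diff_midpoint)
  finally show ?thesis
    by (simp add: W_def)
qed

theorem theorem4p1:
  fixes Nx Ny Nt :: nat and Lx Ly T hx hy \<tau> \<nu> :: real
    and F :: "velocity \<Rightarrow> velocity" and f :: "nat \<Rightarrow> velocity"
  assumes "Nx > 0" and "Ny > 0" and "Nt > 0"
    and "Lx > 0" and "Ly > 0" and "T > 0" and "\<nu> > 0"
    and "hx = Lx / real Nx" and "hy = Ly / real Ny" and "\<tau> = T / real Nt"
    and F_maps: "\<And>U. U \<in> velocity_space Nx Ny \<Longrightarrow> F U \<in> velocity_space Nx Ny"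
    and F_nonzero: "\<And>U. U \<in> velocity_space Nx Ny \<Longrightarrow> norm_h hx hy U \<noteq> 0 \<Longrightarrow>
      inner_h hx hy (F U) U \<noteq> 0"
    and no_force: "\<And>n. n < Nt \<Longrightarrow> f n = velocity_zero Nx Ny"
  shows "(\<forall>U P. CN1 Nx Ny Nt hx hy \<tau> \<nu> F f U P \<longrightarrow>
            (\<forall>n<Nt. dissipation_law Nx Ny hx hy \<tau> \<nu> U n))
       \<and> (\<forall>U P. CN2 Nx Ny Nt hx hy \<tau> \<nu> F f U P \<longrightarrow>
            (\<forall>n. 1 \<le> n \<and> n < Nt \<longrightarrow> dissipation_law Nx Ny hx hy \<tau> \<nu> U n))"
proof (intro conjI allI impI)
  have h: "hx \<ge> 0" "hy \<ge> 0"
    using assms by simp_all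
  fix U P n
  show "dissipation_law Nx Ny hx hy \<tau> \<nu> U n"
    if cn: "CN1 Nx Ny Nt hx hy \<tau> \<nu> F f U P" and n: "n < Nt"
  proof -
    have U: "U n \<in> velocity_space Nx Ny" "U (n + 1) \<in> velocity_space Nx Ny"
      and P: "P n \<in> cell_space Nx Ny"
      and "CN_step Nx Ny hx hy \<tau> \<nu> F (velocity_zero Nx Ny) (U n) (U n) (U (n + 1)) (P n)"
      using cn n no_force[OF n] by (auto simp: CN1_def)
    then show ?thesis
      unfolding dissipation_law_def
      using CN_step_dissipation[where F = F, OF _ U(1) F_maps[OF U(1)] U P h] by simp
  qed
  show "dissipation_law Nx Ny hx hy \<tau> \<nu> U n"
    if cn: "CN2 Nx Ny Nt hx hy \<tau> \<nu> F f U P" and n: "1 \<le> n \<and> n < Nt"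
  proof -
    define Us where "Us = scale (1/2) (scale 3 (U n) - U (n - 1))"
    have U: "\<And>k. k \<le> Nt \<Longrightarrow> U k \<in> velocity_space Nx Ny"
      using cn by (simp add: CN2_def)
    have Us: "Us \<in> velocity_space Nx Ny"
      unfolding Us_def using n by (intro velocity_space_scale velocity_space_diff U) auto
    have "CN_step Nx Ny hx hy \<tau> \<nu> F (velocity_zero Nx Ny) Us (U n) (U (n + 1)) (P n)"
      using cn n no_force[of n] by (auto simp: CN2_def Us_def)
    moreover have "P n \<in> cell_space Nx Ny"
      using cn n by (simp add: CN2_def)
    ultimately show ?thesis
      unfolding dissipation_law_def
      using CN_step_dissipation[where F = F, OF _ Us F_maps[OF Us] _ _ _ h] U n by simp
  qed
qed

end
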